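(* Let $(\Omega,\mathcal{F},\mu)$ be a finite measure space and let $\varphi:\Omega\to\Omega$ be a non-singular transformation. If the composition operator $C_\varphi:L^2(\Omega,\mathcal{F},\mu)\to L^2(\Omega,\mathcal{F},\mu)$ is bounded, then $$C_\varphi^* M_a C_\varphi = M_{\mathcal{L}_\varphi(a)}$$ for every $a\in L^\infty(\Omega,\mathcal{F},\mu)$, where $\mathcal{L}_\varphi$ is the Frobenius-Perron operator of $\varphi$.
   Context: A measurable map $\varphi:\Omega\to\Omega$ is non-singular if $\mu(\varphi^{-1}(E))=0$ whenever $E\in\mathcal{F}$ and $\mu(E)=0$. The composition operator is $C_\varphi f=f\circ\varphi$. For $a\in L^\infty(\Omega,\mathcal{F},\mu)$, $M_a$ is the multiplication operator $M_af=af$ on $L^2(\Omega,\mathcal{F},\mu)$. The Frobenius-Perron operator $\mathcal{L}_\varphi:L^1(\Omega,\mathcal{F},\mu)\to L^1(\Omega,\mathcal{F},\mu)$ is defined by the Radon-Nikodym theorem: for $f\in L^1(\Omega,\mathcal{F},\mu)$, $\mathcal{L}_\varphi(f)$ is the element of $L^1(\Omega,\mathcal{F},\mu)$ with $\int_E\mathcal{L}_\varphi(f)\,d\mu=\int_{\varphi^{-1}(E)}f\,d\mu$ for all $E\in\mathcal{F}$. Boundedness of $C_\varphi$ on $L^p$ for some $1\le p<\infty$ is equivalent to boundedness on $L^p$ for all $1\le p<\infty$ (it is equivalent to boundedness of the Radon-Nikodym derivative $h_\varphi=\frac{d(\varphi_*\mu)}{d\mu}$, where $\varphi_*\mu(E)=\mu(\varphi^{-1}(E))$),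 and in that case $\mathcal{L}_\varphi$ maps $L^\infty(\Omega,\mathcal{F},\mu)$ into itself; the same symbol $\mathcal{L}_\varphi$ denotes this restriction. *)

theory Defs
  imports "HOL-Analysis.Analysis"
begin

text \<open>
  Elements of \<open>L\<^sup>1\<close>, \<open>L\<^sup>2\<close> and \<open>L\<^sup>\<infinity>\<close> are equivalence classes of complex-valued measurable
  functions modulo almost-everywhere equality; values outside \<open>space M\<close> are immaterial.
\<close>

type_synonym 'a fclass = "('a \<Rightarrow> complex) set"

definition ae_eq :: "'a measure \<Rightarrow> ('a \<Rightarrow> complex) rel" where
  "ae_eq M = {(f, g). f \<in> borel_measurable M \<and> g \<in> borel_measurable M \<and> (AE x in M. f x = g x)}"

definition cls :: "'a measure \<Rightarrow> ('a \<Rightarrow> complex) \<Rightarrow> 'a fclass" where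
  "cls M f = ae_eq M `` {f}"

definition rep :: "'a fclass \<Rightarrow> 'a \<Rightarrow> complex" where
  "rep F = (SOME f. f \<in> F)"

definition L1 :: "'a measure \<Rightarrow> 'a fclass set" where
  "L1 M = {f. integrable M f} // ae_eq M"

definition L2 :: "'a measure \<Rightarrow> 'a fclass set" where
  "L2 M = {f \<in> borel_measurable M. integrable M (\<lambda>x. (norm (f x))\<^sup>2)} // ae_eq M"

definition Linf :: "'a measure \<Rightarrow> 'a fclass set" where
  "Linf M = {f \<in> borel_measurable M. \<exists>B. AE x in M. norm (f x) \<le> B} // ae_eq M"

definition L2_inner :: "'a measure \<Rightarrow> 'a fclass \<Rightarrow> 'a fclass \<Rightarrow> complex" where
  "L2_inner M F G = (LINT x|M. rep F x * cnj (rep G x))"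

definition L2_norm :: "'a measure \<Rightarrow> 'a fclass \<Rightarrow> real" where
  "L2_norm M F = sqrt (LINT x|M. (norm (rep F x))\<^sup>2)"

text \<open>
  Linearity is not part of this predicate: it is only applied to composition operators, which
  are linear by construction.
\<close>

definition L2_bounded :: "'a measure \<Rightarrow> ('a fclass \<Rightarrow> 'a fclass) \<Rightarrow> bool" where
  "L2_bounded M T \<longleftrightarrow>
     (\<forall>F\<in>L2 M. T F \<in> L2 M) \<and> (\<exists>K. \<forall>F\<in>L2 M. L2_norm M (T F) \<le> K * L2_norm M F)"

definition L2_adjoint :: "'a measure \<Rightarrow> ('a fclass \<Rightarrow> 'a fclass) \<Rightarrow> 'a fclass \<Rightarrow> 'a fclass" where
  "L2_adjoint M T G =
     (THE H. H \<in> L2 M \<and> (\<forall>F\<in>L2 M. L2_inner M (T F) G = L2_inner M F H))"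

definition nonsingular :: "'a measure \<Rightarrow> ('a \<Rightarrow> 'a) \<Rightarrow> bool" where
  "nonsingular M \<phi> \<longleftrightarrow> \<phi> \<in> measurable M M \<and>
     (\<forall>E\<in>sets M. emeasure M E = 0 \<longrightarrow> emeasure M (\<phi> -` E \<inter> space M) = 0)"

text \<open>The choice of representative in \<open>comp_op\<close> is immaterial when \<open>\<phi>\<close> is non-singular.\<close>

definition comp_op :: "'a measure \<Rightarrow> ('a \<Rightarrow> 'a) \<Rightarrow> 'a fclass \<Rightarrow> 'a fclass" where
  "comp_op M \<phi> F = cls M (rep F \<circ> \<phi>)"

definition mult_op :: "'a measure \<Rightarrow> 'a fclass \<Rightarrow> 'a fclass \<Rightarrow> 'a fclass" where
  "mult_op M A F = cls M (\<lambda>x. rep A x * rep F x)"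

definition frobenius_perron :: "'a measure \<Rightarrow> ('a \<Rightarrow> 'a) \<Rightarrow> 'a fclass \<Rightarrow> 'a fclass" where
  "frobenius_perron M \<phi> F =
     (THE G. G \<in> L1 M \<and>
        (\<forall>E\<in>sets M. (LINT x:E|M. rep G x) = (LINT x:(\<phi> -` E \<inter> space M)|M. rep F x)))"

end

theory Submission
  imports Defs
begin

text \<open>
  Write \<open>g\<close> for a representative of \<open>\<L>\<^sub>\<phi>(a)\<close>. Everything rests on the change-of-variables identity
  \<open>\<integral> (F \<circ> \<phi>) a d\<mu> = \<integral> F g d\<mu>\<close> for every integrable \<open>F\<close>. On indicators \<open>F = 1\<^sub>E\<close> it is the defining
  property of \<open>\<L>\<^sub>\<phi>(a)\<close>; on products \<open>F = r s'\<close>, where \<open>r\<close> and \<open>s\<close> are in \<open>L\<^sup>2\<close> and \<open>s'\<close> is the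
  conjugate of \<open>s\<close>, its conjugate reads \<open>\<langle>C\<^sub>\<phi> s, a C\<^sub>\<phi> r\<rangle> = \<langle>s, g r\<rangle>\<close>, which is the claim tested against \<open>s\<close>.

  To obtain a bounded \<open>g\<close> with this property, apply the bound on \<open>C\<^sub>\<phi>\<close> to indicators: since
  \<open>C\<^sub>\<phi> 1\<^sub>E\<close> is the indicator of the preimage of \<open>E\<close>, the push-forward of \<open>\<mu>\<close> under \<open>\<phi>\<close> is at most
  \<open>K\<^sup>2 \<mu>\<close> (\<open>dominated_pushforward_of_bounded\<close>). Hence for \<open>0 \<le> u \<le> B\<close> the push-forward of \<open>u \<mu>\<close> is
  at most \<open>B K\<^sup>2 \<mu>\<close>, and its Radon-Nikodym derivative is bounded by the same constant
  (\<open>bounded_density_of_dominated\<close>). Linearity passes from nonnegative \<open>u\<close> to complex \<open>a\<close>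
  (\<open>transfers_bounded\<close>).

  That the two definite descriptions pick out the classes of \<open>g\<close> and of \<open>g f\<close> is uniqueness: a
  function in \<open>L\<^sup>1\<close> is determined by its set integrals, and an element of \<open>L\<^sup>2\<close> by its inner products.
\<close>

section \<open>Equivalence classes and their representatives\<close>

lemma cls_cong:
  assumes "f \<in> borel_measurable M" "g \<in> borel_measurable M" "AE x in M. f x = g x"
  shows "cls M f = cls M g"
proof -
  have "(AE x in M. f x = h x) \<longleftrightarrow> (AE x in M. g x = h x)" for h
  proof
    show "AE x in M. g x = h x" if "AE x in M. f x = h x"
      using assms(3) that by eventually_elim simp
    show "AE x in M. f x = h x" if "AE x in M. g x = h x"
      using assms(3) that by eventually_elim simp
  qed
  then show ?thesis
    using assms(1,2) by (auto simp: cls_def ae_eq_def)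
qed

lemma rep_cls:
  assumes "f \<in> borel_measurable M"
  shows "rep (cls M f) \<in> borel_measurable M" "AE x in M. rep (cls M f) x = f x"
proof -
  have "f \<in> cls M f"
    using assms by (simp add: cls_def ae_eq_def)
  then have "rep (cls M f) \<in> cls M f"
    unfolding rep_def by (rule someI[where P = "\<lambda>h. h \<in> cls M f"])
  then show "rep (cls M f) \<in> borel_measurable M" "AE x in M. rep (cls M f) x = f x"
    by (auto simp: cls_def ae_eq_def)
qed

lemma quotient_cls: "S // ae_eq M = cls M ` S"
  by (auto simp: quotient_def cls_def)

lemma cls_rep:
  assumes "f \<in> borel_measurable M"
  shows "cls M (rep (cls M f)) = cls M f"
  using rep_cls[OF assms] assms by (intro cls_cong)

lemma L1_rep:
  assumes "F \<in> L1 M"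
  shows "cls M (rep F) = F" "integrable M (rep F)"
proof -
  obtain f where f: "integrable M f" "F = cls M f"
    using assms by (auto simp: L1_def quotient_cls)
  have fm: "f \<in> borel_measurable M"
    using f(1) by (rule borel_measurable_integrable)
  show "cls M (rep F) = F"
    unfolding f(2) by (rule cls_rep[OF fm])
  show "integrable M (rep F)"
    unfolding f(2) using integrable_cong_AE[OF rep_cls(1)[OF fm] fm rep_cls(2)[OF fm]] f(1) by blast
qed

lemma L2_rep:
  assumes "F \<in> L2 M"
  shows "cls M (rep F) = F" "rep F \<in> borel_measurable M"
    "integrable M (\<lambda>x. (norm (rep F x))\<^sup>2)"
proof -
  obtain f where fm [measurable]: "f \<in> borel_measurable M"
    and f: "integrable M (\<lambda>x. (norm (f x))\<^sup>2)" "F = cls M f"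
    using assms by (auto simp: L2_def quotient_cls)
  note [measurable] = rep_cls(1)[OF fm]
  show "cls M (rep F) = F"
    unfolding f(2) by (rule cls_rep[OF fm])
  show "rep F \<in> borel_measurable M"
    unfolding f(2) by (rule rep_cls(1)[OF fm])
  have "AE x in M. (norm (rep (cls M f) x))\<^sup>2 = (norm (f x))\<^sup>2"
    using rep_cls(2)[OF fm] by eventually_elim simp
  then have "integrable M (\<lambda>x. (norm (rep (cls M f) x))\<^sup>2)
      \<longleftrightarrow> integrable M (\<lambda>x. (norm (f x))\<^sup>2)"
    by (intro integrable_cong_AE) measurable
  then show "integrable M (\<lambda>x. (norm (rep F x))\<^sup>2)"
    using f by simp
qed

lemma cls_in_L1: "integrable M f \<Longrightarrow> cls M f \<in> L1 M"
  by (auto simp: L1_def quotient_cls)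

lemma cls_in_L2:
  "f \<in> borel_measurable M \<Longrightarrow> integrable M (\<lambda>x. (norm (f x))\<^sup>2) \<Longrightarrow> cls M f \<in> L2 M"
  by (auto simp: L2_def quotient_cls)

lemma cls_in_Linf:
  "f \<in> borel_measurable M \<Longrightarrow> AE x in M. norm (f x) \<le> B \<Longrightarrow> cls M f \<in> Linf M"
  by (auto simp: Linf_def quotient_cls)

lemma Linf_rep:
  assumes "A \<in> Linf M"
  obtains B where "rep A \<in> borel_measurable M" "AE x in M. norm (rep A x) \<le> B"
proof -
  obtain f B where f: "f \<in> borel_measurable M" "AE x in M. norm (f x) \<le> B" "A = cls M f"
    using assms by (auto simp: Linf_def quotient_cls)
  have "AE x in M. norm (rep A x) \<le> B"
    using rep_cls(2)[OF f(1)] f(2) unfolding f(3) by eventually_elim simp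
  then show thesis
    using that rep_cls(1)[OF f(1)] f(3) by blast
qed

lemma borel_measurable_cnj [measurable (raw)]:
  "f \<in> borel_measurable M \<Longrightarrow> (\<lambda>x. cnj (f x)) \<in> borel_measurable M"
  by (rule borel_measurable_continuous_on[of cnj]) (auto intro: continuous_intros)

lemma integrable_mult_cnj_L2:
  fixes f g :: "'a \<Rightarrow> complex"
  assumes [measurable]: "f \<in> borel_measurable M" "g \<in> borel_measurable M"
    and "integrable M (\<lambda>x. (norm (f x))\<^sup>2)" "integrable M (\<lambda>x. (norm (g x))\<^sup>2)"
  shows "integrable M (\<lambda>x. f x * cnj (g x))"
proof (rule Bochner_Integration.integrable_bound)
  show "integrable M (\<lambda>x. (norm (f x))\<^sup>2 + (norm (g x))\<^sup>2)"
    using assms by auto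
  have "norm (f x * cnj (g x)) \<le> (norm (f x))\<^sup>2 + (norm (g x))\<^sup>2" for x
  proof -
    have "2 * (norm (f x) * norm (g x)) \<le> (norm (f x))\<^sup>2 + (norm (g x))\<^sup>2"
      using sum_squares_bound[of "norm (f x)" "norm (g x)"] by simp
    moreover have "0 \<le> norm (f x) * norm (g x)"
      by simp
    ultimately show ?thesis
      unfolding norm_mult complex_mod_cnj by linarith
  qed
  then show "AE x in M. norm (f x * cnj (g x)) \<le> norm ((norm (f x))\<^sup>2 + (norm (g x))\<^sup>2)"
    by auto
qed measurable

lemma integrable_mult_bounded:
  fixes f g :: "'a \<Rightarrow> complex"
  assumes "integrable M f" "g \<in> borel_measurable M" "AE x in M. norm (g x) \<le> B"
  shows "integrable M (\<lambda>x. f x * g x)"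
proof (rule Bochner_Integration.integrable_bound)
  show "integrable M (\<lambda>x. B * norm (f x))"
    using assms by auto
  show "AE x in M. norm (f x * g x) \<le> norm (B * norm (f x))"
    using assms(3)
  proof eventually_elim
    case (elim x)
    have "norm (g x) * norm (f x) \<le> B * norm (f x)"
      using elim by (intro mult_right_mono) auto
    also have "\<dots> \<le> norm (B * norm (f x))"
      by simp
    finally show ?case
      by (simp add: norm_mult mult.commute)
  qed
qed (use assms in measurable)

lemma L2_inner_cls:
  assumes [measurable]: "f \<in> borel_measurable M" "g \<in> borel_measurable M"
  shows "L2_inner M (cls M f) (cls M g) = (LINT x|M. f x * cnj (g x))"
proof -
  note [measurable] = rep_cls(1)[OF assms(1)] rep_cls(1)[OF assms(2)]
  show ?thesis
    unfolding L2_inner_def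
    using rep_cls(2)[OF assms(1)] rep_cls(2)[OF assms(2)]
    by (intro integral_cong_AE) auto
qed

text \<open>Testing against the difference \<open>H - H'\<close> itself makes its norm vanish.\<close>

lemma L2_eqI:
  assumes H: "H \<in> L2 M" and H': "H' \<in> L2 M"
    and eq: "\<And>F. F \<in> L2 M \<Longrightarrow> L2_inner M F H = L2_inner M F H'"
  shows "H = H'"
proof -
  define h h' where "h = rep H" and "h' = rep H'"
  have hm [measurable]: "h \<in> borel_measurable M" "h' \<in> borel_measurable M"
    and hi: "integrable M (\<lambda>x. (norm (h x))\<^sup>2)" "integrable M (\<lambda>x. (norm (h' x))\<^sup>2)"
    and hH: "H = cls M h" "H' = cls M h'"
    unfolding h_def h'_def by (simp_all add: H H' L2_rep)
  define d where "d = (\<lambda>x. h x - h' x)"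
  have dm [measurable]: "d \<in> borel_measurable M"
    unfolding d_def by measurable
  have di: "integrable M (\<lambda>x. (norm (d x))\<^sup>2)"
  proof (rule Bochner_Integration.integrable_bound)
    show "integrable M (\<lambda>x. 2 * (norm (h x))\<^sup>2 + 2 * (norm (h' x))\<^sup>2)"
      using hi by auto
    have "(norm (d x))\<^sup>2 \<le> 2 * (norm (h x))\<^sup>2 + 2 * (norm (h' x))\<^sup>2" for x
    proof -
      have "(norm (d x))\<^sup>2 \<le> (norm (h x) + norm (h' x))\<^sup>2"
        unfolding d_def by (intro power_mono norm_triangle_ineq4) auto
      also have "\<dots> \<le> 2 * (norm (h x))\<^sup>2 + 2 * (norm (h' x))\<^sup>2"
        using sum_squares_bound[of "norm (h x)" "norm (h' x)"] by (simp add: power2_sum)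
      finally show ?thesis .
    qed
    then show "AE x in M. norm ((norm (d x))\<^sup>2) \<le> norm (2 * (norm (h x))\<^sup>2 + 2 * (norm (h' x))\<^sup>2)"
      by auto
  qed measurable
  have "L2_inner M (cls M d) H = L2_inner M (cls M d) H'"
    by (intro eq cls_in_L2 dm di)
  then have "(LINT x|M. d x * cnj (h x)) = (LINT x|M. d x * cnj (h' x))"
    by (simp add: hH L2_inner_cls)
  then have "(LINT x|M. d x * cnj (h x) - d x * cnj (h' x)) = 0"
    using integrable_mult_cnj_L2[OF dm hm(1) di hi(1)] integrable_mult_cnj_L2[OF dm hm(2) di hi(2)]
    by (simp add: Bochner_Integration.integral_diff)
  moreover have "d x * cnj (h x) - d x * cnj (h' x) = complex_of_real ((norm (d x))\<^sup>2)" for x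
    unfolding complex_norm_square by (simp add: d_def algebra_simps)
  ultimately have "(LINT x|M. (norm (d x))\<^sup>2) = 0"
    by (simp only: integral_complex_of_real of_real_eq_0_iff)
  then have "AE x in M. (norm (d x))\<^sup>2 = 0"
    using integral_nonneg_eq_0_iff_AE[OF di] by simp
  then have "AE x in M. h x = h' x"
    by (simp add: d_def)
  then show ?thesis
    unfolding hH by (intro cls_cong hm)
qed

section \<open>Bounded densities\<close>

text \<open>
  A Radon-Nikodym derivative \<open>f\<close> of \<open>N\<close> cannot exceed \<open>D\<close> on a set \<open>E\<close> of positive measure: there
  \<open>f - D\<close> is positive, but its integral over \<open>E\<close> is \<open>N(E) - D \<mu>(E) \<le> 0\<close>. Truncating \<open>f\<close> at \<open>D\<close>
  gives a version that is real-valued and bounded everywhere.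
\<close>

lemma (in finite_measure) bounded_density_of_dominated:
  assumes sets: "sets N = sets M" and "0 \<le> D"
    and dom: "\<And>E. E \<in> sets M \<Longrightarrow> emeasure N E \<le> ennreal D * emeasure M E"
  obtains g :: "'a \<Rightarrow> real"
  where "g \<in> borel_measurable M" "\<And>x. 0 \<le> g x" "\<And>x. g x \<le> D" "density M g = N"
proof -
  have "absolutely_continuous M N"
    using dom sets by (fastforce simp: absolutely_continuous_def null_sets_def)
  then obtain f where fm [measurable]: "f \<in> borel_measurable M" and dens: "density M f = N"
    using sets Radon_Nikodym by blast
  define E where "E = {x \<in> space M. ennreal D < f x}"
  have E [measurable]: "E \<in> sets M"
    unfolding E_def by measurable
  have "(\<integral>\<^sup>+x. (f x * indicator E x - ennreal D * indicator E x) \<partial>M)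
      = (\<integral>\<^sup>+x. f x * indicator E x \<partial>M) - (\<integral>\<^sup>+x. ennreal D * indicator E x \<partial>M)"
  proof (rule nn_integral_diff)
    show "(\<integral>\<^sup>+x. ennreal D * indicator E x \<partial>M) \<noteq> \<infinity>"
      by (simp add: nn_integral_cmult_indicator ennreal_mult_eq_top_iff)
  qed (auto simp: E_def indicator_def less_imp_le)
  also have "\<dots> = emeasure N E - ennreal D * emeasure M E"
    using emeasure_density[OF fm E] by (simp add: dens nn_integral_cmult_indicator)
  also have "\<dots> = 0"
  proof (rule diff_eq_0_ennreal)
    show "emeasure N E < top"
      using dom[OF E] by (rule le_less_trans) (simp add: ennreal_mult_less_top emeasure_eq_measure)
  qed (rule dom[OF E])
  finally have "AE x in M. f x * indicator E x - ennreal D * indicator E x = 0"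
    by (rule nn_integral_0_iff_AE[THEN iffD1, rotated]) measurable
  then have le: "AE x in M. f x \<le> ennreal D"
    using AE_space
  proof eventually_elim
    case (elim x)
    then show ?case
      by (cases "x \<in> E") (auto simp: E_def diff_eq_0_iff_ennreal not_less)
  qed
  define g where "g = (\<lambda>x. enn2real (min (f x) (ennreal D)))"
  have fin: "min (f x) (ennreal D) < top" for x
    by (simp add: min_less_iff_disj)
  show thesis
  proof
    show gm [measurable]: "g \<in> borel_measurable M"
      unfolding g_def by measurable
    show "0 \<le> g x" for x
      by (simp add: g_def)
    show "g x \<le> D" for x
      unfolding g_def using \<open>0 \<le> D\<close> by (intro enn2real_leI) auto
    have "AE x in M. f x = ennreal (g x)"
      using le
    proof eventually_elim
      case (elim x)
      then have "min (f x) (ennreal D) = f x"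
        by (rule min_absorb1)
      then show ?case
        using fin[of x] by (simp add: g_def)
    qed
    then have "density M f = density M g"
      by (rule density_cong[rotated 2]) measurable
    then show "density M g = N"
      using dens by simp
  qed
qed

section \<open>The transfer identity\<close>

text \<open>
  This is boundedness of the Radon-Nikodym derivative \<open>h\<^sub>\<phi>\<close>, phrased through measures of
  sets; non-singularity of \<open>\<phi>\<close> is the case of null sets.
\<close>

locale dominated_pushforward = finite_measure M for M :: "'a measure" +
  fixes \<phi> :: "'a \<Rightarrow> 'a" and C :: real
  assumes map_measurable [measurable]: "\<phi> \<in> measurable M M"
    and C_nonneg: "0 \<le> C"
    and dominated: "\<And>E. E \<in> sets M \<Longrightarrow>
      emeasure M (\<phi> -` E \<inter> space M) \<le> ennreal C * emeasure M E"
begin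

lemma integrable_comp:
  fixes F :: "'a \<Rightarrow> complex"
  assumes F: "integrable M F"
  shows "integrable M (\<lambda>x. F (\<phi> x))"
proof -
  have [measurable]: "F \<in> borel_measurable M"
    using F by auto
  obtain h :: "'a \<Rightarrow> real" where h [measurable]: "h \<in> borel_measurable M"
    and hb: "\<And>x. 0 \<le> h x" "\<And>x. h x \<le> C" and dens: "density M h = distr M M \<phi>"
    by (rule bounded_density_of_dominated[of "distr M M \<phi>" C])
      (auto simp: C_nonneg emeasure_distr dominated)
  have "integrable M (\<lambda>x. F x * complex_of_real (h x))"
    by (rule integrable_mult_bounded[OF F, where B = C]) (use hb in \<open>auto simp: abs_of_nonneg\<close>)
  then have "integrable (density M h) F"
    by (subst integrable_density) (auto simp: hb scaleR_conv_of_real mult.commute)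
  then show ?thesis
    unfolding dens by (simp add: integrable_distr_eq)
qed

text \<open>
  \<open>transfers a g\<close> is the working form of \<open>\<L>\<^sub>\<phi>(a) = g\<close>. Testing against all integrable \<open>F\<close>, not
  only indicators, is what the adjoint computation needs. The bounds on \<open>a\<close> and \<open>g\<close> make all
  integrands integrable, so that the relation is linear.
\<close>

definition transfers :: "('a \<Rightarrow> complex) \<Rightarrow> ('a \<Rightarrow> complex) \<Rightarrow> bool" where
  "transfers a g \<longleftrightarrow>
     a \<in> borel_measurable M \<and> (\<exists>B. AE x in M. norm (a x) \<le> B) \<and>
     g \<in> borel_measurable M \<and> (\<exists>B. AE x in M. norm (g x) \<le> B) \<and>
     (\<forall>F. integrable M F \<longrightarrow> (LINT x|M. F (\<phi> x) * a x) = (LINT x|M. F x * g x))"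

lemma transfers_add:
  assumes "transfers a g" "transfers b k"
  shows "transfers (\<lambda>x. a x + b x) (\<lambda>x. g x + k x)"
proof -
  obtain A B G K where
    a: "a \<in> borel_measurable M" "AE x in M. norm (a x) \<le> A" and
    b: "b \<in> borel_measurable M" "AE x in M. norm (b x) \<le> B" and
    g: "g \<in> borel_measurable M" "AE x in M. norm (g x) \<le> G" and
    k: "k \<in> borel_measurable M" "AE x in M. norm (k x) \<le> K"
    using assms by (auto simp: transfers_def)
  have "AE x in M. norm (a x + b x) \<le> A + B"
    using a(2) b(2) by eventually_elim (rule norm_triangle_mono)
  moreover have "AE x in M. norm (g x + k x) \<le> G + K"
    using g(2) k(2) by eventually_elim (rule norm_triangle_mono)
  moreover have "(LINT x|M. F (\<phi> x) * (a x + b x)) = (LINT x|M. F x * (g x + k x))"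
    if F: "integrable M F" for F
  proof -
    note c = integrable_comp[OF F]
    have "(LINT x|M. F (\<phi> x) * (a x + b x))
        = (LINT x|M. F (\<phi> x) * a x) + (LINT x|M. F (\<phi> x) * b x)"
      unfolding distrib_left
      by (intro Bochner_Integration.integral_add integrable_mult_bounded[OF c a]
          integrable_mult_bounded[OF c b])
    also have "\<dots> = (LINT x|M. F x * g x) + (LINT x|M. F x * k x)"
      using assms F by (simp add: transfers_def)
    also have "\<dots> = (LINT x|M. F x * (g x + k x))"
      unfolding distrib_left
      by (intro Bochner_Integration.integral_add[symmetric] integrable_mult_bounded[OF F g]
          integrable_mult_bounded[OF F k])
    finally show ?thesis .
  qed
  moreover have "(\<lambda>x. a x + b x) \<in> borel_measurable M" "(\<lambda>x. g x + k x) \<in> borel_measurable M"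
    using a(1) b(1) g(1) k(1) by measurable
  ultimately show ?thesis
    unfolding transfers_def by blast
qed

lemma transfers_cmult:
  assumes "transfers a g"
  shows "transfers (\<lambda>x. c * a x) (\<lambda>x. c * g x)"
proof -
  obtain A G where
    a: "a \<in> borel_measurable M" "AE x in M. norm (a x) \<le> A" and
    g: "g \<in> borel_measurable M" "AE x in M. norm (g x) \<le> G"
    using assms by (auto simp: transfers_def)
  have "AE x in M. norm (c * a x) \<le> norm c * A"
    using a(2) by eventually_elim (simp add: norm_mult mult_left_mono)
  moreover have "AE x in M. norm (c * g x) \<le> norm c * G"
    using g(2) by eventually_elim (simp add: norm_mult mult_left_mono)
  moreover have "(LINT x|M. F (\<phi> x) * (c * a x)) = (LINT x|M. F x * (c * g x))"
    if F: "integrable M F" for F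
    using assms F by (simp add: transfers_def mult.left_commute[of _ c])
  moreover have "(\<lambda>x. c * a x) \<in> borel_measurable M" "(\<lambda>x. c * g x) \<in> borel_measurable M"
    using a(1) g(1) by measurable
  ultimately show ?thesis
    unfolding transfers_def by blast
qed

text \<open>
  For nonnegative \<open>u\<close> the function \<open>g\<close> is the density of an actual measure, the push-forward of
  \<open>u \<mu>\<close>, so the identity is the composition of the integral formulas for densities and
  for image measures.
\<close>

lemma transfers_nonneg:
  fixes u :: "'a \<Rightarrow> real"
  assumes u [measurable]: "u \<in> borel_measurable M"
    and nonneg: "AE x in M. 0 \<le> u x" and bound: "AE x in M. u x \<le> B" and "0 \<le> B"
  obtains g where "transfers (\<lambda>x. complex_of_real (u x)) g"
proof -
  define N where "N = distr (density M u) M \<phi>"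
  have \<phi>u: "\<phi> \<in> measurable (density M u) M"
    by simp
  have dom: "emeasure N E \<le> ennreal (B * C) * emeasure M E" if E [measurable]: "E \<in> sets M" for E
  proof -
    have "emeasure N E = (\<integral>\<^sup>+x. ennreal (u x) * indicator (\<phi> -` E \<inter> space M) x \<partial>M)"
      using \<phi>u by (simp add: N_def emeasure_distr emeasure_density)
    also have "\<dots> \<le> (\<integral>\<^sup>+x. ennreal B * indicator (\<phi> -` E \<inter> space M) x \<partial>M)"
      using bound by (intro nn_integral_mono_AE) (auto intro!: mult_right_mono ennreal_leI)
    also have "\<dots> = ennreal B * emeasure M (\<phi> -` E \<inter> space M)"
      by (simp add: nn_integral_cmult_indicator)
    also have "\<dots> \<le> ennreal B * (ennreal C * emeasure M E)"
      by (intro mult_left_mono dominated E) simp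
    also have "\<dots> = ennreal (B * C) * emeasure M E"
      using \<open>0 \<le> B\<close> C_nonneg by (simp add: ennreal_mult mult.assoc)
    finally show ?thesis .
  qed
  obtain g :: "'a \<Rightarrow> real" where g [measurable]: "g \<in> borel_measurable M"
    and gb: "\<And>x. 0 \<le> g x" "\<And>x. g x \<le> B * C" and dens: "density M g = N"
    by (rule bounded_density_of_dominated[of N "B * C"])
      (use \<open>0 \<le> B\<close> C_nonneg dom in \<open>auto simp: N_def\<close>)
  have "(LINT x|M. F (\<phi> x) * complex_of_real (u x)) = (LINT x|M. F x * complex_of_real (g x))"
    if "integrable M F" for F
  proof -
    have [measurable]: "F \<in> borel_measurable M"
      using that by auto
    have "(LINT x|M. F x * complex_of_real (g x)) = integral\<^sup>L (density M g) F"
      by (subst integral_density) (auto simp: gb scaleR_conv_of_real mult.commute)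
    also have "\<dots> = (LINT x|density M u. F (\<phi> x))"
      unfolding dens N_def using \<phi>u by (intro integral_distr) auto
    also have "\<dots> = (LINT x|M. F (\<phi> x) * complex_of_real (u x))"
      by (subst integral_density) (auto simp: nonneg scaleR_conv_of_real mult.commute)
    finally show ?thesis ..
  qed
  moreover have "AE x in M. norm (complex_of_real (u x)) \<le> B"
    using nonneg bound by eventually_elim simp
  moreover have "AE x in M. norm (complex_of_real (g x)) \<le> B * C"
    using gb by (simp add: abs_of_nonneg)
  ultimately have "transfers (\<lambda>x. complex_of_real (u x)) (\<lambda>x. complex_of_real (g x))"
    unfolding transfers_def using u g by auto
  then show thesis
    by (rule that)
qed

text \<open>
  Shifting the real and imaginary parts by a bound \<open>K\<close> makes them nonnegative; the shift
  \<open>(1 + \<i>) K\<close> is removed again by transferring the constant \<open>K\<close>.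
\<close>

lemma transfers_bounded:
  fixes a :: "'a \<Rightarrow> complex"
  assumes a [measurable]: "a \<in> borel_measurable M" and bound: "AE x in M. norm (a x) \<le> B"
  obtains g where "transfers a g"
proof -
  define K where "K = max B 0"
  have K: "0 \<le> K" and ri: "AE x in M. \<bar>Re (a x)\<bar> \<le> K \<and> \<bar>Im (a x)\<bar> \<le> K"
  proof -
    show "AE x in M. \<bar>Re (a x)\<bar> \<le> K \<and> \<bar>Im (a x)\<bar> \<le> K"
      using bound
    proof eventually_elim
      case (elim x)
      then show ?case
        using abs_Re_le_cmod[of "a x"] abs_Im_le_cmod[of "a x"] unfolding K_def by linarith
    qed
  qed (simp add: K_def)
  obtain g where g: "transfers (\<lambda>x. complex_of_real (Re (a x) + K)) g"
    by (rule transfers_nonneg[of "\<lambda>x. Re (a x) + K" "2 * K"]) (use ri K in auto)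
  obtain k where k: "transfers (\<lambda>x. complex_of_real (Im (a x) + K)) k"
    by (rule transfers_nonneg[of "\<lambda>x. Im (a x) + K" "2 * K"]) (use ri K in auto)
  obtain h where h: "transfers (\<lambda>x. complex_of_real K) h"
    by (rule transfers_nonneg[of "\<lambda>x. K" K]) (use K in auto)
  note transfers_add[OF transfers_add[OF g transfers_cmult[OF k, of \<i>]]
      transfers_cmult[OF h, of "- 1 - \<i>"]]
  moreover have "complex_of_real (Re (a x) + K) + \<i> * complex_of_real (Im (a x) + K)
      + (- 1 - \<i>) * complex_of_real K = a x" for x
    by (simp add: complex_eq_iff)
  ultimately show thesis
    using that by simp
qed

text \<open>
  The transfer identity for \<open>F = 1\<^sub>E\<close> shows that \<open>g\<close> has the set integrals that define
  \<open>\<L>\<^sub>\<phi>(A)\<close>, and set integrals determine a class in \<open>L\<^sup>1\<close>.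
\<close>

lemma frobenius_perron_eq:
  assumes tr: "transfers (rep A) g"
  shows "frobenius_perron M \<phi> A = cls M g"
proof -
  obtain G where g [measurable]: "g \<in> borel_measurable M" and gb: "AE x in M. norm (g x) \<le> G"
    using tr by (auto simp: transfers_def)
  have gi: "integrable M g"
    using gb by (intro integrable_const_bound[of _ G]) auto
  define P where "P = (\<lambda>H. H \<in> L1 M \<and>
      (\<forall>E\<in>sets M. (LINT x:E|M. rep H x) = (LINT x:(\<phi> -` E \<inter> space M)|M. rep A x)))"
  have "(LINT x:E|M. rep (cls M g) x) = (LINT x:(\<phi> -` E \<inter> space M)|M. rep A x)"
    if E [measurable]: "E \<in> sets M" for E
  proof -
    have iE: "integrable M (\<lambda>x. indicator E x :: complex)"
      by (rule integrable_const_bound[of _ 1]) (auto simp: indicator_def)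
    have "(LINT x:E|M. rep (cls M g) x) = (LINT x:E|M. g x)"
      using rep_cls[OF g] by (intro set_lebesgue_integral_cong_AE) auto
    also have "\<dots> = (LINT x|M. indicator E x * g x)"
      unfolding set_lebesgue_integral_def
      by (intro Bochner_Integration.integral_cong) (auto simp: indicator_def)
    also have "\<dots> = (LINT x|M. indicator E (\<phi> x) * rep A x)"
      using tr iE by (simp add: transfers_def)
    also have "\<dots> = (LINT x:(\<phi> -` E \<inter> space M)|M. rep A x)"
      unfolding set_lebesgue_integral_def
      by (intro Bochner_Integration.integral_cong) (auto simp: indicator_def)
    finally show ?thesis .
  qed
  then have Pg: "P (cls M g)"
    using cls_in_L1[OF gi] by (simp add: P_def)
  have "H = cls M g" if "P H" for H
  proof -
    have H: "cls M (rep H) = H" "integrable M (rep H)"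
      using that by (simp_all add: P_def L1_rep)
    have G: "integrable M (rep (cls M g))"
      using Pg by (simp add: P_def L1_rep)
    have "AE x in M. rep H x = rep (cls M g) x"
      using that Pg by (intro density_unique_banach H G) (simp add: P_def)
    then have "cls M (rep H) = cls M (rep (cls M g))"
      using H(2) G by (intro cls_cong) auto
    then show ?thesis
      using H(1) cls_rep[OF g] by simp
  qed
  then have "(THE H. P H) = cls M g"
    using Pg by (rule the_equality[rotated])
  then show ?thesis
    by (simp add: frobenius_perron_def P_def)
qed

text \<open>
  In the inner product of \<open>C\<^sub>\<phi> F\<close> with \<open>M\<^sub>A C\<^sub>\<phi> f\<close> the two compositions merge into a single
  function composed with \<open>\<phi>\<close>, and this function is integrable as a product of two elements of
  \<open>L\<^sup>2\<close>. The second argument is conjugated, so the transfer identity is applied to the conjugate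
  of the integral, where \<open>rep A\<close> appears unconjugated.
\<close>

lemma adjoint_mult_comp_eq:
  assumes tr: "transfers (rep A) g" and f: "f \<in> L2 M"
  shows "L2_adjoint M (comp_op M \<phi>) (mult_op M A (comp_op M \<phi> f)) = cls M (\<lambda>x. g x * rep f x)"
proof -
  obtain G where gm [measurable]: "g \<in> borel_measurable M" and gb: "AE x in M. norm (g x) \<le> G"
    and am [measurable]: "rep A \<in> borel_measurable M"
    using tr by (auto simp: transfers_def)
  define r where "r = rep f"
  have rm [measurable]: "r \<in> borel_measurable M" and ri: "integrable M (\<lambda>x. (norm (r x))\<^sup>2)"
    unfolding r_def by (simp_all add: f L2_rep)
  have comp: "rep (comp_op M \<phi> f) \<in> borel_measurable M"
      "AE x in M. rep (comp_op M \<phi> f) x = r (\<phi> x)"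
    using rep_cls[of "\<lambda>x. r (\<phi> x)" M] by (simp_all add: comp_op_def r_def[symmetric] comp_def)
  have Y: "mult_op M A (comp_op M \<phi> f) = cls M (\<lambda>x. rep A x * r (\<phi> x))"
    unfolding mult_op_def using comp by (intro cls_cong) auto
  have gri: "integrable M (\<lambda>x. (norm (g x * r x))\<^sup>2)"
  proof (rule Bochner_Integration.integrable_bound)
    show "integrable M (\<lambda>x. G\<^sup>2 * (norm (r x))\<^sup>2)"
      using ri by auto
    show "AE x in M. norm ((norm (g x * r x))\<^sup>2) \<le> norm (G\<^sup>2 * (norm (r x))\<^sup>2)"
      using gb by eventually_elim (auto simp: norm_mult power_mult_distrib intro!: mult_right_mono power_mono)
  qed measurable
  have in_L2: "cls M (\<lambda>x. g x * r x) \<in> L2 M"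
    using gri by (intro cls_in_L2) auto
  have adj: "L2_inner M (comp_op M \<phi> F) (mult_op M A (comp_op M \<phi> f))
      = L2_inner M F (cls M (\<lambda>x. g x * r x))" if F: "F \<in> L2 M" for F
  proof -
    define s where "s = rep F"
    have sm [measurable]: "s \<in> borel_measurable M" and si: "integrable M (\<lambda>x. (norm (s x))\<^sup>2)"
      and Fs: "F = cls M s"
      unfolding s_def by (simp_all add: F L2_rep)
    have CF: "comp_op M \<phi> F = cls M (\<lambda>x. s (\<phi> x))"
      by (simp add: comp_op_def s_def comp_def)
    have "L2_inner M (comp_op M \<phi> F) (mult_op M A (comp_op M \<phi> f))
        = (LINT x|M. s (\<phi> x) * cnj (rep A x * r (\<phi> x)))"
      unfolding CF Y by (intro L2_inner_cls) measurable
    also have "\<dots> = cnj (LINT x|M. (r (\<phi> x) * cnj (s (\<phi> x))) * rep A x)"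
      by (simp add: Bochner_Integration.integral_cnj[symmetric] mult_ac del: Bochner_Integration.integral_cnj)
    also have "(LINT x|M. (r (\<phi> x) * cnj (s (\<phi> x))) * rep A x) = (LINT x|M. (r x * cnj (s x)) * g x)"
      using tr integrable_mult_cnj_L2[OF rm sm ri si] unfolding transfers_def by blast
    also have "cnj \<dots> = (LINT x|M. s x * cnj (g x * r x))"
      by (simp add: Bochner_Integration.integral_cnj[symmetric] mult_ac del: Bochner_Integration.integral_cnj)
    also have "\<dots> = L2_inner M F (cls M (\<lambda>x. g x * r x))"
      unfolding Fs by (intro L2_inner_cls[symmetric]) measurable
    finally show ?thesis .
  qed
  show ?thesis
    unfolding L2_adjoint_def r_def[symmetric]
  proof (rule the_equality)
    show "cls M (\<lambda>x. g x * r x) \<in> L2 M \<and> (\<forall>F\<in>L2 M.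
        L2_inner M (comp_op M \<phi> F) (mult_op M A (comp_op M \<phi> f))
        = L2_inner M F (cls M (\<lambda>x. g x * r x)))"
      using in_L2 adj by blast
    show "H = cls M (\<lambda>x. g x * r x)"
      if "H \<in> L2 M \<and> (\<forall>F\<in>L2 M.
        L2_inner M (comp_op M \<phi> F) (mult_op M A (comp_op M \<phi> f)) = L2_inner M F H)" for H
      using that adj by (intro L2_eqI[OF _ in_L2]) auto
  qed
qed

end

section \<open>Boundedness of the composition operator\<close>

text \<open>
  The squared norm of an indicator is the measure of the set, so the operator bound \<open>K\<close>, tested on
  indicators, gives domination with constant \<open>K\<^sup>2\<close>.
\<close>

lemma dominated_pushforward_of_bounded:
  assumes "finite_measure M" "nonsingular M \<phi>" "L2_bounded M (comp_op M \<phi>)"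
  obtains C where "dominated_pushforward M \<phi> C"
proof -
  interpret finite_measure M by fact
  have \<phi> [measurable]: "\<phi> \<in> measurable M M"
    and null: "\<And>E. E \<in> sets M \<Longrightarrow> emeasure M E = 0 \<Longrightarrow> emeasure M (\<phi> -` E \<inter> space M) = 0"
    using assms(2) by (auto simp: nonsingular_def)
  obtain K where K: "\<And>F. F \<in> L2 M \<Longrightarrow> L2_norm M (comp_op M \<phi> F) \<le> K * L2_norm M F"
    using assms(3) by (auto simp: L2_bounded_def)
  have norm_cls: "L2_norm M (cls M (indicator E)) = sqrt (measure M E)"
    if E [measurable]: "E \<in> sets M" for E
  proof -
    note r = rep_cls[of "indicator E" M]
    note [measurable] = r(1)
    have "(LINT x|M. (norm (rep (cls M (indicator E)) x))\<^sup>2) = (LINT x|M. indicator E x)"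
    proof (rule integral_cong_AE)
      show "AE x in M. (norm (rep (cls M (indicator E)) x))\<^sup>2 = indicator E x"
        using r(2) by (auto simp: indicator_def)
    qed auto
    then show ?thesis
      by (simp add: L2_norm_def)
  qed
  have "emeasure M (\<phi> -` E \<inter> space M) \<le> ennreal (K\<^sup>2) * emeasure M E"
    if E [measurable]: "E \<in> sets M" for E
  proof -
    define e where "e = rep (cls M (indicator E))"
    have e [measurable]: "e \<in> borel_measurable M" and eE: "AE x in M. e x = indicator E x"
      using rep_cls[of "indicator E" M] by (auto simp: e_def)
    \<comment> \<open>The chosen representative \<open>e\<close> agrees with the indicator only almost everywhere;
      non-singularity keeps the exceptional set null under preimages.\<close>
    have "AE x in distr M M \<phi>. e x = indicator E x"
    proof -
      have "absolutely_continuous M (distr M M \<phi>)"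
        using null by (auto simp: absolutely_continuous_def null_sets_def emeasure_distr)
      then show ?thesis
        using eE by (intro absolutely_continuous_AE[of "distr M M \<phi>" M]) auto
    qed
    then have e\<phi>: "AE x in M. e (\<phi> x) = indicator E (\<phi> x)"
      by (subst (asm) AE_distr_iff) auto
    have "comp_op M \<phi> (cls M (indicator E)) = cls M (indicator (\<phi> -` E \<inter> space M))"
      unfolding comp_op_def e_def[symmetric]
    proof (rule cls_cong)
      show "AE x in M. (e \<circ> \<phi>) x = indicator (\<phi> -` E \<inter> space M) x"
        using e\<phi> AE_space by eventually_elim (simp add: indicator_def)
    qed auto
    moreover have "cls M (indicator E) \<in> L2 M"
    proof (rule cls_in_L2)
      have "(norm (indicator E x :: complex))\<^sup>2 = indicator E x" for x
        by (simp add: indicator_def)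
      then show "integrable M (\<lambda>x. (norm (indicator E x :: complex))\<^sup>2)"
        by (simp add: emeasure_eq_measure)
    qed auto
    ultimately have "sqrt (measure M (\<phi> -` E \<inter> space M)) \<le> K * sqrt (measure M E)"
      using K[of "cls M (indicator E)"] by (simp add: norm_cls)
    then have "(sqrt (measure M (\<phi> -` E \<inter> space M)))\<^sup>2 \<le> (K * sqrt (measure M E))\<^sup>2"
      by (intro power_mono) auto
    then have "measure M (\<phi> -` E \<inter> space M) \<le> K\<^sup>2 * measure M E"
      by (simp add: power_mult_distrib)
    then show ?thesis
      by (simp add: emeasure_eq_measure ennreal_mult[symmetric] ennreal_leI)
  qed
  then have "dominated_pushforward M \<phi> (K\<^sup>2)"
    by unfold_locales auto
  then show thesis
    by (rule that)
qed

theorem proposition2p2: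
  fixes M :: "'a measure" and \<phi> :: "'a \<Rightarrow> 'a"
  assumes "finite_measure M"
    and "nonsingular M \<phi>"
    and "L2_bounded M (comp_op M \<phi>)"
  shows "\<forall>a\<in>Linf M. frobenius_perron M \<phi> a \<in> Linf M \<and>
           (\<forall>f\<in>L2 M. (L2_adjoint M (comp_op M \<phi>) \<circ> mult_op M a \<circ> comp_op M \<phi>) f
                    = mult_op M (frobenius_perron M \<phi> a) f)"
proof
  fix a assume "a \<in> Linf M"
  then obtain B where a: "rep a \<in> borel_measurable M" "AE x in M. norm (rep a x) \<le> B"
    by (rule Linf_rep)
  obtain C where "dominated_pushforward M \<phi> C"
    using assms by (rule dominated_pushforward_of_bounded)
  then interpret dominated_pushforward M \<phi> C .
  obtain g where tr: "transfers (rep a) g"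
    using a by (rule transfers_bounded)
  then obtain G where g [measurable]: "g \<in> borel_measurable M" "AE x in M. norm (g x) \<le> G"
    by (auto simp: transfers_def)
  have "mult_op M (cls M g) f = cls M (\<lambda>x. g x * rep f x)" if "f \<in> L2 M" for f
  proof -
    have "rep f \<in> borel_measurable M"
      using that by (rule L2_rep(2))
    then show ?thesis
      unfolding mult_op_def using rep_cls[OF g(1)] by (intro cls_cong) auto
  qed
  then show "frobenius_perron M \<phi> a \<in> Linf M \<and>
      (\<forall>f\<in>L2 M. (L2_adjoint M (comp_op M \<phi>) \<circ> mult_op M a \<circ> comp_op M \<phi>) f
               = mult_op M (frobenius_perron M \<phi> a) f)"
    using frobenius_perron_eq[OF tr] adjoint_mult_comp_eq[OF tr] cls_in_Linf[OF g] by simp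
qed

end
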